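(* Let $T\ge3$ and let $K$ be the largest integer with $K\le (T-1)/2$, in the discrete choice model with unobserved choice sets described in the context. Suppose that $F_t^{\mathrm{RUM}}(y\mid D,x)>0$ for every $x\in X$, $D\in\mathcal{D}_x$, $t\in\mathcal{T}$ and $y\in D$, and that one of the following conditions holds: (i) (Nestedness) for every $x\in X$, $\mathcal{D}_x$ is a collection of nested sets, i.e. $\mathcal{D}_x=\{D_k\}_{k=1}^{d_{D,x}}$ with $D_{k-1}\subseteq D_k$ for $k=2,\dots,d_{D,x}$; (ii) (Excluded choices) for every $x\in X$, $\mathcal{D}_x=\{D_k\}_{k=1}^{d_{D,x}}$ is such that for every $k$ there exists $y_k\in\mathcal{Y}$ with $y_k\in D_k$ but $y_k\notin D_{k'}$ for all $k'\ne k$. Then for every $x\in X$ and every $\mathcal{T}^*\subseteq\mathcal{T}$ with $|\mathcal{T}^*|=K$, the functions $\{G(\cdot\mid D,x,\mathcal{T}^* )\}_{D\in\mathcal{D}_x}$ on $\mathcal{Y}^K$ are linearly independent; that is, if $\sum_{D\in\mathcal{D}_x}\alpha_D\,G(y^K\mid D,x,\mathcal{T}^* )=0$ for all $y^K\in\mathcal{Y}^K$, then $\alpha_D=0$ for all $D\in\mathcal{D}_x$.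
   Context: Model. $\mathcal{Y}=\{1,\dots,Y\}$ is a finite grand set of alternatives and $\mathcal{T}=\{1,\dots,T\}$ the set of time periods. A decision maker has observed covariates $\mathbf{x}\in X\subseteq\mathbb{R}^{d_x}$ and an unobserved random choice set $\mathbf{D}$, a nonempty subset of $\mathcal{Y}$ which does not change over time. At each $t\in\mathcal{T}$ she has a random utility function $\mathbf{u}_t:\mathcal{Y}\to\mathbb{R}$ representing a strict preference order, and she chooses $\mathbf{y}_t=y^{\mathrm{RUM}}(\mathbf{D},\mathbf{u}_t)$, where $y^{\mathrm{RUM}}(D,u_t)=\arg\max_{y'\in D}u_t(y')$. Notation. $\mathcal{D}_x$ is the conditional support of $\mathbf{D}$ given $\mathbf{x}=x$, a collection of nonempty subsets of $\mathcal{Y}$, and $d_{D,x}=|\mathcal{D}_x|$ (in the enumerations $\{D_k\}_{k=1}^{d_{D,x}}$ the $D_k$ are pairwise distinct). For $D\in\mathcal{D}_x$, $$F_t^{\mathrm{RUM}}(y\mid D,x)=\Pr(y^{\mathrm{RUM}}(\mathbf{D},\mathbf{u}_t)=y\mid\mathbf{x}=x,\mathbf{D}=D),$$ so $F_t^{\mathrm{RUM}}(y\mid D,x)=0$ if $y\notin D$. For $\mathcal{T}^*\subseteq\mathcal{T}$ with $|\mathcal{T}^*|=K$, let $\mathbf{y}(\mathcal{T}^* )=(\mathbf{y}_t)_{t\in\mathcal{T}^*}\in\mathcal{Y}^K$ and, for $y^K\in\mathcal{Y}^K$, $$G(y^K\mid D,x,\mathcal{T}^* )=\Pr(\mathbf{y}(\mathcal{T}^*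 )=y^K\mid\mathbf{D}=D,\mathbf{x}=x).$$ *)

theory Defs
  imports "HOL-Probability.Probability"
begin

text \<open>Conditioning on the event that the covariates equal \<open>x\<close>, which may be a null event, refers to a
  version \<open>\<kappa>\<close> of the regular conditional probability given the covariates.  The covariates take values
  in the set \<open>X\<close>, which carries the trace of the Borel sigma-algebra.\<close>

definition regular_cond_prob ::
  "'w measure \<Rightarrow> 'b measure \<Rightarrow> ('w \<Rightarrow> 'b) \<Rightarrow> ('b \<Rightarrow> 'w measure) \<Rightarrow> bool"
where
  "regular_cond_prob M N xc \<kappa> \<longleftrightarrow>
     \<kappa> \<in> measurable N (prob_algebra M) \<and>
     (\<forall>A\<in>sets M. \<forall>B\<in>sets N.
        emeasure M {\<omega>\<in>space M. \<omega> \<in> A \<and> xc \<omega> \<in> B}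
          = (\<integral>\<^sup>+ x \<in> B. emeasure (\<kappa> x) A \<partial>distr M N xc))"

locale choice_model = prob_space M
  for M :: "'w measure" +
  fixes Y T :: nat
    and X :: "(real ^ 'd) set"
    and xc :: "'w \<Rightarrow> real ^ 'd"
    and \<kappa> :: "real ^ 'd \<Rightarrow> 'w measure"
    and D :: "'w \<Rightarrow> nat set"
    and u :: "nat \<Rightarrow> 'w \<Rightarrow> nat \<Rightarrow> real"
  assumes covariates: "xc \<in> measurable M (restrict_space borel X)"
    and conditional: "regular_cond_prob M (restrict_space borel X) xc \<kappa>"
    and choice_set: "D \<in> measurable M (count_space (Pow {1..Y} - {{}}))"
    and utility: "\<And>t y. t \<in> {1..T} \<Longrightarrow> y \<in> {1..Y} \<Longrightarrow> (\<lambda>\<omega>. u t \<omega> y) \<in> borel_measurable M"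
    and strict: "\<And>t \<omega>. t \<in> {1..T} \<Longrightarrow> \<omega> \<in> space M \<Longrightarrow> inj_on (u t \<omega>) {1..Y}"

definition y_RUM :: "nat set \<Rightarrow> (nat \<Rightarrow> real) \<Rightarrow> nat" where
  "y_RUM S v = arg_max_on v S"

text \<open>The choice set takes finitely many values, so its conditional support consists of the values of
  positive conditional probability.\<close>

definition cond_support ::
  "('b \<Rightarrow> 'w measure) \<Rightarrow> ('w \<Rightarrow> nat set) \<Rightarrow> 'b \<Rightarrow> nat set set"
where
  "cond_support \<kappa> D x = {S. \<P>(\<omega> in \<kappa> x. D \<omega> = S) > 0}"

definition F_RUM ::
  "('b \<Rightarrow> 'w measure) \<Rightarrow> ('w \<Rightarrow> nat set) \<Rightarrow> (nat \<Rightarrow> 'w \<Rightarrow> nat \<Rightarrow> real) \<Rightarrow>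
   nat \<Rightarrow> nat \<Rightarrow> nat set \<Rightarrow> 'b \<Rightarrow> real"
where
  "F_RUM \<kappa> D u t y S x = \<P>(\<omega> in \<kappa> x. y_RUM (D \<omega>) (u t \<omega>) = y \<bar> D \<omega> = S)"

text \<open>A tuple of choices over the periods in \<open>Ts\<close> is an extensional function on \<open>Ts\<close>, so the power
  of \<open>{1..Y}\<close> with exponent \<open>card Ts\<close> appears as \<open>Ts \<rightarrow>\<^sub>E {1..Y}\<close>.\<close>

definition choices ::
  "('w \<Rightarrow> nat set) \<Rightarrow> (nat \<Rightarrow> 'w \<Rightarrow> nat \<Rightarrow> real) \<Rightarrow> nat set \<Rightarrow> 'w \<Rightarrow> nat \<Rightarrow> nat"
where
  "choices D u Ts \<omega> = (\<lambda>t\<in>Ts. y_RUM (D \<omega>) (u t \<omega>))"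

definition G ::
  "('b \<Rightarrow> 'w measure) \<Rightarrow> ('w \<Rightarrow> nat set) \<Rightarrow> (nat \<Rightarrow> 'w \<Rightarrow> nat \<Rightarrow> real) \<Rightarrow>
   (nat \<Rightarrow> nat) \<Rightarrow> nat set \<Rightarrow> 'b \<Rightarrow> nat set \<Rightarrow> real"
where
  "G \<kappa> D u ys S x Ts = \<P>(\<omega> in \<kappa> x. choices D u Ts \<omega> = ys \<bar> D \<omega> = S)"

definition nested :: "nat set set \<Rightarrow> bool" where
  "nested \<D> \<longleftrightarrow>
     (\<exists>Dk. bij_betw Dk {1..card \<D>} \<D> \<and> (\<forall>k\<in>{2..card \<D>}. Dk (k - 1) \<subseteq> Dk k))"

definition excluded_choices :: "nat \<Rightarrow> nat set set \<Rightarrow> bool" where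
  "excluded_choices Y \<D> \<longleftrightarrow>
     (\<exists>Dk. bij_betw Dk {1..card \<D>} \<D> \<and>
        (\<forall>k\<in>{1..card \<D>}. \<exists>y\<in>{1..Y}. y \<in> Dk k \<and> (\<forall>k'\<in>{1..card \<D>}. k' \<noteq> k \<longrightarrow> y \<notin> Dk k')))"

end

theory Submission
  imports Defs
begin

text \<open>Summing \<open>G\<close> over the choices in all periods but one turns the linear relation among the \<open>G\<close> into
  the same relation among the \<open>F_RUM\<close> of a single period; there is one, as \<open>K \<ge> 1\<close>.  Under either
  condition each \<open>D_k\<close> contains an alternative which lies in no \<open>D_j\<close> with \<open>j < k\<close>, so evaluating at
  these alternatives gives a triangular system with positive diagonal.\<close>

text \<open>Back substitution from the last index down: at the point chosen for \<open>k\<close>,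
  terms with smaller index vanish by triangularity and terms with larger index by the induction
  hypothesis, so only the diagonal term is left.\<close>

lemma triangular_system_trivial:
  fixes f :: "'a \<Rightarrow> 'b \<Rightarrow> real" and n :: nat
  assumes e: "bij_betw e {1..n} A"
    and triangular: "\<And>k. k \<in> {1..n} \<Longrightarrow> \<exists>y\<in>B. f (e k) y \<noteq> 0 \<and> (\<forall>j\<in>{1..<k}. f (e j) y = 0)"
    and relation: "\<And>y. y \<in> B \<Longrightarrow> (\<Sum>S\<in>A. \<alpha> S * f S y) = 0"
    and "S \<in> A"
  shows "\<alpha> S = 0"
proof -
  have vanish: "\<alpha> (e k) = 0" if "k \<in> {1..n}" for k
    using that
  proof (induction "n - k" arbitrary: k rule: less_induct)
    case less
    obtain y where y: "y \<in> B" "f (e k) y \<noteq> 0" "\<And>j. j \<in> {1..<k} \<Longrightarrow> f (e j) y = 0"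
      using triangular[OF less.prems] by blast
    have off_diagonal: "\<alpha> (e j) * f (e j) y = 0" if j: "j \<in> {1..n} - {k}" for j
    proof (cases "j < k")
      case True
      then show ?thesis using y(3)[of j] j by simp
    next
      case False
      then have "n - j < n - k" using j less.prems by auto
      then show ?thesis using less.hyps[of j] j by simp
    qed
    have "0 = (\<Sum>j\<in>{1..n}. \<alpha> (e j) * f (e j) y)"
      using relation[OF y(1)] sum.reindex_bij_betw[OF e, of "\<lambda>S. \<alpha> S * f S y"] by simp
    also have "\<dots> = \<alpha> (e k) * f (e k) y + (\<Sum>j\<in>{1..n} - {k}. \<alpha> (e j) * f (e j) y)"
      using less.prems by (intro sum.remove) auto
    also have "(\<Sum>j\<in>{1..n} - {k}. \<alpha> (e j) * f (e j) y) = 0"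
      using off_diagonal by (intro sum.neutral) blast
    finally show ?case using y(2) by simp
  qed
  show ?thesis using e \<open>S \<in> A\<close> vanish unfolding bij_betw_def by blast
qed

text \<open>\<open>arg_max_on\<close> is a Hilbert choice, so membership depends on the existence of
  a maximiser, which finiteness and nonemptiness supply.\<close>

lemma y_RUM_in:
  assumes "finite S" "S \<noteq> {}"
  shows "y_RUM S v \<in> S"
proof -
  have "Max (v ` S) \<in> v ` S" using assms by simp
  then obtain y where "y \<in> S" "v y = Max (v ` S)" by force
  then have "is_arg_max v (\<lambda>y. y \<in> S) y"
    using assms(1) by (simp add: is_arg_max_linorder)
  then have "\<exists>y. is_arg_max v (\<lambda>y. y \<in> S) y" by blast
  then have "is_arg_max v (\<lambda>y. y \<in> S) (y_RUM S v)"
    unfolding y_RUM_def arg_max_on_def arg_max_def by (rule someI_ex)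
  then show ?thesis by (simp add: is_arg_max_def)
qed

text \<open>Injectivity of the enumeration makes each inclusion in the chain strict. An alternative
  gained in passing from \<open>Dk (k - 1)\<close> to \<open>Dk k\<close> is missing from all
  earlier sets, since these lie inside \<open>Dk (k - 1)\<close>; for \<open>k = 1\<close> any
  element will do.\<close>

lemma nested_new_alternative:
  fixes n :: nat
  assumes "bij_betw Dk {1..n} \<D>" and "\<forall>k\<in>{2..n}. Dk (k - 1) \<subseteq> Dk k"
    and "{} \<notin> \<D>" and k: "k \<in> {1..n}"
  shows "\<exists>y\<in>Dk k. \<forall>j\<in>{1..<k}. y \<notin> Dk j"
proof (cases "k = 1")
  case True
  have "Dk k \<in> \<D>" using assms(1) k by (auto simp: bij_betw_def)
  then have "Dk k \<noteq> {}" using assms(3) by metis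
  then show ?thesis using True by auto
next
  case False
  have mono: "Dk i \<subseteq> Dk j" if "i \<le> j" "1 \<le> i" "j \<le> n" for i j
    using that
  proof (induction j rule: dec_induct)
    case (step j)
    then show ?case using assms(2)[rule_format, of "Suc j"] by auto
  qed simp
  then have below: "Dk j \<subseteq> Dk (k - 1)" if "j \<in> {1..<k}" for j
    using that k by (intro mono) auto
  have "Dk (k - 1) \<subseteq> Dk k" using assms(2) k False by auto
  moreover have "Dk (k - 1) \<noteq> Dk k"
  proof
    assume "Dk (k - 1) = Dk k"
    then have "k - 1 = k"
      by (rule inj_onD[OF bij_betw_imp_inj_on[OF assms(1)]]) (use k False in auto)
    then show False using k by auto
  qed
  ultimately obtain y where "y \<in> Dk k" "y \<notin> Dk (k - 1)" by blast
  then show ?thesis using below by blast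
qed

context choice_model
begin

text \<open>These facts hold at every point of \<open>X\<close>, not just almost everywhere, because
  \<open>\<kappa>\<close> maps into \<open>prob_algebra M\<close>.\<close>

lemma kernel:
  assumes "x \<in> X"
  shows "prob_space (\<kappa> x)" and "sets (\<kappa> x) = sets M" and "space (\<kappa> x) = space M"
proof -
  have "\<kappa> \<in> measurable (restrict_space borel X) (prob_algebra M)"
    using conditional by (simp add: regular_cond_prob_def)
  from measurable_space[OF this, of x] assms
  show "prob_space (\<kappa> x)" and sets_eq: "sets (\<kappa> x) = sets M"
    by (auto simp: space_restrict_space space_prob_algebra)
  from sets_eq show "space (\<kappa> x) = space M" by (rule sets_eq_imp_space_eq)
qed

lemma choice_set_in: "\<omega> \<in> space M \<Longrightarrow> D \<omega> \<subseteq> {1..Y} \<and> D \<omega> \<noteq> {}"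
  using measurable_space[OF choice_set] by auto

lemma y_RUM_in_choice_set: "\<omega> \<in> space M \<Longrightarrow> y_RUM (D \<omega>) v \<in> D \<omega>"
  by (meson choice_set_in y_RUM_in finite_subset finite_atLeastAtMost)

text \<open>An event of positive probability is nonempty, so \<open>S\<close> is a value that
  \<open>D\<close> really attains.\<close>

lemma cond_support_subset:
  assumes "x \<in> X" "S \<in> cond_support \<kappa> D x"
  shows "S \<subseteq> {1..Y}" "S \<noteq> {}"
proof -
  have "{\<omega>\<in>space (\<kappa> x). D \<omega> = S} \<noteq> {}"
    using assms(2) by (auto simp: cond_support_def simp del: Collect_empty_eq)
  then show "S \<subseteq> {1..Y}" "S \<noteq> {}"
    using choice_set_in kernel(3)[OF assms(1)] by auto
qed

text \<open>The numerator of the conditional probability is the measure of an empty event, so the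
  quotient is 0 whatever its denominator.\<close>

lemma F_RUM_eq_0:
  assumes "x \<in> X" "y \<notin> S"
  shows "F_RUM \<kappa> D u t y S x = 0"
proof -
  have "{\<omega>\<in>space (\<kappa> x). y_RUM (D \<omega>) (u t \<omega>) = y \<and> D \<omega> = S} = {}"
    using y_RUM_in_choice_set kernel(3)[OF assms(1)] assms(2) by auto
  then show ?thesis by (simp add: F_RUM_def cond_prob_def del: Collect_empty_eq)
qed

text \<open>Marginalisation by finite additivity: the full choice tuples that agree with
  \<open>y\<close> in period \<open>s\<close> partition the event of choosing \<open>y\<close> in
  that period.\<close>

lemma sum_G_eq_F_RUM:
  assumes x: "x \<in> X" and Ts: "finite Ts" "s \<in> Ts"
    and pos: "\<And>t y. t \<in> Ts \<Longrightarrow> y \<in> S \<Longrightarrow> F_RUM \<kappa> D u t y S x > 0"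
  shows "(\<Sum>ys | ys \<in> Ts \<rightarrow>\<^sub>E {1..Y} \<and> ys s = y. G \<kappa> D u ys S x Ts) = F_RUM \<kappa> D u s y S x"
proof -
  interpret k: prob_space "\<kappa> x" by (rule kernel(1)[OF x])
  note space = kernel(3)[OF x]
  define C where "C t y = {\<omega>\<in>space (\<kappa> x). y_RUM (D \<omega>) (u t \<omega>) = y \<and> D \<omega> = S}" for t y
  define E where "E ys = {\<omega>\<in>space (\<kappa> x). choices D u Ts \<omega> = ys \<and> D \<omega> = S}" for ys
  define I where "I = {ys \<in> Ts \<rightarrow>\<^sub>E {1..Y}. ys s = y}"
  \<comment> \<open>Sets outside the sigma-algebra have measure 0, so positivity entails measurability.\<close>
  have C_sets: "C t y \<in> sets (\<kappa> x)" if "t \<in> Ts" for t y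
  proof (cases "y \<in> S")
    case True
    then have "measure (\<kappa> x) (C t y) \<noteq> 0"
      using pos[OF that True] by (auto simp: F_RUM_def cond_prob_def C_def)
    then show ?thesis using measure_notin_sets by blast
  next
    case False
    then have "C t y = {}" using y_RUM_in_choice_set space by (auto simp: C_def)
    then show ?thesis by simp
  qed
  \<comment> \<open>The period \<open>s\<close> keeps the intersection from being over an empty
    family, so it stays inside the space and carries the condition
    \<open>D \<omega> = S\<close>.\<close>
  have E_eq: "E ys = (\<Inter>t\<in>Ts. C t (ys t))" if "ys \<in> I" for ys
    using that Ts(2) by (auto simp: E_def C_def I_def choices_def fun_eq_iff PiE_def extensional_def)
  have E_sets: "E ys \<in> sets (\<kappa> x)" if "ys \<in> I" for ys
    unfolding E_eq[OF that] using Ts C_sets by (intro sets.finite_INT) auto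
  have fin: "finite I"
    unfolding I_def using Ts(1) by (intro finite_subset[OF _ finite_PiE[of Ts "\<lambda>_. {1..Y}"]]) auto
  have "C s y = (\<Union>ys\<in>I. E ys)"
  proof (intro equalityI subsetI)
    fix \<omega> assume \<omega>: "\<omega> \<in> C s y"
    then have "\<omega> \<in> space M" using space by (simp add: C_def)
    then have "y_RUM (D \<omega>) (u t \<omega>) \<in> {1..Y}" for t
      using y_RUM_in_choice_set choice_set_in by blast
    then have "choices D u Ts \<omega> \<in> I"
      using \<omega> Ts(2) by (auto simp: I_def choices_def C_def)
    then show "\<omega> \<in> (\<Union>ys\<in>I. E ys)" using \<omega> by (auto simp: E_def C_def)
  next
    fix \<omega> assume "\<omega> \<in> (\<Union>ys\<in>I. E ys)"
    then show "\<omega> \<in> C s y" using Ts(2) by (auto simp: E_def C_def I_def choices_def)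
  qed
  moreover have "disjoint_family_on E I" by (auto simp: disjoint_family_on_def E_def)
  ultimately have "measure (\<kappa> x) (C s y) = (\<Sum>ys\<in>I. measure (\<kappa> x) (E ys))"
    using k.finite_measure_finite_Union[OF fin] E_sets by auto
  \<comment> \<open>Both sides divide by the same probability of \<open>D \<omega> = S\<close>, so
    equality of the numerators suffices.\<close>
  then show ?thesis
    by (simp add: G_def F_RUM_def cond_prob_def C_def E_def I_def flip: sum_divide_distrib)
qed

text \<open>Brings both structural conditions to the one property that makes the system triangular.
  An excluded choice avoids all other sets, in particular the earlier ones.\<close>

lemma new_alternative:
  assumes x: "x \<in> X"
    and "nested (cond_support \<kappa> D x) \<or> excluded_choices Y (cond_support \<kappa> D x)"
  obtains Dk where "bij_betw Dk {1..card (cond_support \<kappa> D x)} (cond_support \<kappa> D x)"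
    and "\<And>k. k \<in> {1..card (cond_support \<kappa> D x)} \<Longrightarrow> \<exists>y\<in>Dk k. \<forall>j\<in>{1..<k}. y \<notin> Dk j"
  using assms(2)
proof
  assume "nested (cond_support \<kappa> D x)"
  moreover have "{} \<notin> cond_support \<kappa> D x" using cond_support_subset[OF x] by blast
  ultimately show ?thesis
    using that nested_new_alternative unfolding nested_def by metis
next
  let ?n = "card (cond_support \<kappa> D x)"
  assume "excluded_choices Y (cond_support \<kappa> D x)"
  then obtain Dk where Dk: "bij_betw Dk {1..?n} (cond_support \<kappa> D x)"
    and excluded: "\<And>k. k \<in> {1..?n} \<Longrightarrow> \<exists>y. y \<in> Dk k \<and> (\<forall>j\<in>{1..?n}. j \<noteq> k \<longrightarrow> y \<notin> Dk j)"
    unfolding excluded_choices_def by blast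
  show ?thesis
  proof (rule that[OF Dk])
    fix k assume k: "k \<in> {1..?n}"
    then obtain y where "y \<in> Dk k" "\<And>j. j \<in> {1..?n} \<Longrightarrow> j \<noteq> k \<Longrightarrow> y \<notin> Dk j"
      using excluded by blast
    then show "\<exists>y\<in>Dk k. \<forall>j\<in>{1..<k}. y \<notin> Dk j" using k by (intro bexI[of _ y]) auto
  qed
qed

lemma G_linearly_independent:
  assumes x: "x \<in> X" and Ts: "finite Ts" "Ts \<noteq> {}"
    and pos: "\<And>S t y. S \<in> cond_support \<kappa> D x \<Longrightarrow> t \<in> Ts \<Longrightarrow> y \<in> S \<Longrightarrow> F_RUM \<kappa> D u t y S x > 0"
    and struct: "nested (cond_support \<kappa> D x) \<or> excluded_choices Y (cond_support \<kappa> D x)"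
    and relation: "\<And>ys. ys \<in> Ts \<rightarrow>\<^sub>E {1..Y} \<Longrightarrow>
      (\<Sum>S\<in>cond_support \<kappa> D x. \<alpha> S * G \<kappa> D u ys S x Ts) = 0"
    and S: "S \<in> cond_support \<kappa> D x"
  shows "\<alpha> S = 0"
proof -
  let ?\<D> = "cond_support \<kappa> D x"
  obtain s where s: "s \<in> Ts" using Ts(2) by blast
  obtain Dk where Dk: "bij_betw Dk {1..card ?\<D>} ?\<D>"
    and new: "\<And>k. k \<in> {1..card ?\<D>} \<Longrightarrow> \<exists>y\<in>Dk k. \<forall>j\<in>{1..<k}. y \<notin> Dk j"
    using new_alternative[OF x struct] by blast
  show ?thesis
  \<comment> \<open>Testing at all of \<open>UNIV\<close> is harmless: for \<open>y\<close> outside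
    \<open>{1..Y}\<close> no tuple has \<open>ys s = y\<close>, and the marginal sum is
    empty.\<close>
  proof (rule triangular_system_trivial[OF Dk _ _ S, where B = UNIV and f = "\<lambda>S y. F_RUM \<kappa> D u s y S x"])
    fix k assume k: "k \<in> {1..card ?\<D>}"
    then have "Dk k \<in> ?\<D>" using Dk by (auto simp: bij_betw_def)
    \<comment> \<open>The new alternative of \<open>Dk k\<close> gives a positive diagonal entry by
      \<open>pos\<close>, and zeros for the earlier sets, which do not contain it.\<close>
    then show "\<exists>y\<in>UNIV. F_RUM \<kappa> D u s y (Dk k) x \<noteq> 0 \<and> (\<forall>j\<in>{1..<k}. F_RUM \<kappa> D u s y (Dk j) x = 0)"
      using new[OF k] pos[OF _ s] F_RUM_eq_0[OF x] by (metis less_irrefl UNIV_I)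
  next
    fix y
    have "(\<Sum>S\<in>?\<D>. \<alpha> S * F_RUM \<kappa> D u s y S x)
        = (\<Sum>S\<in>?\<D>. \<Sum>ys | ys \<in> Ts \<rightarrow>\<^sub>E {1..Y} \<and> ys s = y. \<alpha> S * G \<kappa> D u ys S x Ts)"
      using sum_G_eq_F_RUM[OF x Ts(1) s] pos by (intro sum.cong) (simp_all flip: sum_distrib_left)
    also have "\<dots> = (\<Sum>ys | ys \<in> Ts \<rightarrow>\<^sub>E {1..Y} \<and> ys s = y. \<Sum>S\<in>?\<D>. \<alpha> S * G \<kappa> D u ys S x Ts)"
      by (rule sum.swap)
    also have "\<dots> = 0" using relation by (intro sum.neutral) simp
    finally show "(\<Sum>S\<in>?\<D>. \<alpha> S * F_RUM \<kappa> D u s y S x) = 0" .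
  qed
qed

end

theorem proposition2:
  fixes M :: "'w measure"
    and Y T K :: nat
    and X :: "(real ^ 'd) set"
    and xc :: "'w \<Rightarrow> real ^ 'd"
    and \<kappa> :: "real ^ 'd \<Rightarrow> 'w measure"
    and D :: "'w \<Rightarrow> nat set"
    and u :: "nat \<Rightarrow> 'w \<Rightarrow> nat \<Rightarrow> real"
  assumes "choice_model M Y T X xc \<kappa> D u"
    and "T \<ge> 3"
    and "int K = \<lfloor>(real T - 1) / 2\<rfloor>"
    and "\<forall>x\<in>X. \<forall>S\<in>cond_support \<kappa> D x. \<forall>t\<in>{1..T}. \<forall>y\<in>S. F_RUM \<kappa> D u t y S x > 0"
    and "(\<forall>x\<in>X. nested (cond_support \<kappa> D x)) \<or>
         (\<forall>x\<in>X. excluded_choices Y (cond_support \<kappa> D x))"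
  shows "\<forall>x\<in>X. \<forall>Ts. Ts \<subseteq> {1..T} \<and> card Ts = K \<longrightarrow>
           (\<forall>\<alpha> :: nat set \<Rightarrow> real.
              (\<forall>ys \<in> Ts \<rightarrow>\<^sub>E {1..Y}. (\<Sum>S\<in>cond_support \<kappa> D x. \<alpha> S * G \<kappa> D u ys S x Ts) = 0)
              \<longrightarrow> (\<forall>S\<in>cond_support \<kappa> D x. \<alpha> S = 0))"
proof (intro ballI allI impI)
  fix x Ts and \<alpha> :: "nat set \<Rightarrow> real" and S
  assume x: "x \<in> X" and Ts: "Ts \<subseteq> {1..T} \<and> card Ts = K"
    and relation: "\<forall>ys \<in> Ts \<rightarrow>\<^sub>E {1..Y}. (\<Sum>S\<in>cond_support \<kappa> D x. \<alpha> S * G \<kappa> D u ys S x Ts) = 0"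
    and S: "S \<in> cond_support \<kappa> D x"
  interpret choice_model M Y T X xc \<kappa> D u by (rule assms(1))
  \<comment> \<open>\<open>T \<ge> 3\<close> is exactly what makes \<open>K\<close> at least 1, so
    that there is a period to marginalise to.\<close>
  have "1 \<le> \<lfloor>(real T - 1) / 2\<rfloor>" using assms(2) by (simp add: le_floor_iff)
  then have "card Ts \<noteq> 0" using assms(3) Ts by linarith
  \<comment> \<open>Infinite sets have \<open>card\<close> equal to 0, so a nonzero
    \<open>card\<close> yields finiteness as well as nonemptiness.\<close>
  then have fin: "finite Ts" and ne: "Ts \<noteq> {}" by (auto intro: card_ge_0_finite)
  show "\<alpha> S = 0"
  proof (rule G_linearly_independent[OF x fin ne _ _ _ S])
    show "nested (cond_support \<kappa> D x) \<or> excluded_choices Y (cond_support \<kappa> D x)"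
      using assms(5) x by blast
  qed (use assms(4) x Ts relation in auto)
qed

end
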